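(* Let $Q$ be an $n$-ary quasigroup with $n\ge3$. If every residual ternary quasigroup of $Q$ is isotopic to an iterated group (not necessarily the same group for all of them), then $Q$ is isotopic to an iterated group.
   Context: An $n$-ary quasigroup is a set $Q$ with $f:Q^n\to Q$ such that $f(x_1,\dots,x_n)=x_0$ is uniquely solvable for any one $x_i$ given the others. A residual ternary quasigroup of $Q$ is the ternary operation on $Q$ in three of the variables $x_1,\dots,x_n$ obtained from $f$ by fixing the values of the remaining $n-3$ variables. Operations $f:Q^k\to Q$ and $g:Q_1^k\to Q_1$ are isotopic if there are bijections $\alpha_0,\dots,\alpha_k:Q\to Q_1$ with $g(\alpha_1(x_1),\dots,\alpha_k(x_k))=\alpha_0(f(x_1,\dots,x_k))$. An iterated group is an operation $(x_1,\dots,x_k)\mapsto x_1x_2\cdots x_k$ computed in a group. *)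

theory Defs
  imports "HOL-Algebra.Group" "HOL-Library.FuncSet"
begin

text \<open>The set \<open>Q\<^sup>k\<close> is rendered as \<open>{1..k} \<rightarrow>\<^sub>E Q\<close>, so that \<open>x i\<close> is the \<open>i\<close>-th
  coordinate (counted from 1) of a \<open>k\<close>-tuple \<open>x\<close>; a \<open>k\<close>-ary operation on \<open>Q\<close> only matters
  on these extensional tuples.\<close>

text \<open>Unique solvability for \<open>x\<^sub>0\<close> is the condition that \<open>f\<close> maps \<open>Q\<^sup>n\<close> into \<open>Q\<close>.
  As usual, the underlying set of a quasigroup is nonempty.\<close>

definition nary_quasigroup :: "nat \<Rightarrow> 'a set \<Rightarrow> ((nat \<Rightarrow> 'a) \<Rightarrow> 'a) \<Rightarrow> bool" where
  "nary_quasigroup n Q f \<longleftrightarrow>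
     Q \<noteq> {} \<and>
     f \<in> ({1..n} \<rightarrow>\<^sub>E Q) \<rightarrow> Q \<and>
     (\<forall>i\<in>{1..n}. \<forall>x\<in>{1..n} - {i} \<rightarrow>\<^sub>E Q. \<forall>x0\<in>Q. \<exists>!y. y \<in> Q \<and> f (x(i := y)) = x0)"

text \<open>The three free variables keep the order they have in \<open>f\<close>; this matters for being
  isotopic to an iterated nonabelian group. For \<open>n = 3\<close> nothing is fixed and the only
  residual ternary operation is \<open>f\<close> itself.\<close>

definition residual_ternary_quasigroups ::
    "nat \<Rightarrow> 'a set \<Rightarrow> ((nat \<Rightarrow> 'a) \<Rightarrow> 'a) \<Rightarrow> ((nat \<Rightarrow> 'a) \<Rightarrow> 'a) set" where
  "residual_ternary_quasigroups n Q f =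
     {(\<lambda>y. f (c(i := y 1, j := y 2, k := y 3))) | i j k c.
        1 \<le> i \<and> i < j \<and> j < k \<and> k \<le> n \<and> c \<in> {1..n} - {i, j, k} \<rightarrow>\<^sub>E Q}"

definition isotopic ::
    "nat \<Rightarrow> 'a set \<Rightarrow> ((nat \<Rightarrow> 'a) \<Rightarrow> 'a) \<Rightarrow> 'b set \<Rightarrow> ((nat \<Rightarrow> 'b) \<Rightarrow> 'b) \<Rightarrow> bool" where
  "isotopic k Q f Q1 g \<longleftrightarrow>
     (\<exists>\<alpha>. (\<forall>i\<in>{0..k}. bij_betw (\<alpha> i) Q Q1) \<and>
          (\<forall>x\<in>{1..k} \<rightarrow>\<^sub>E Q. g (\<lambda>i\<in>{1..k}. \<alpha> i (x i)) = \<alpha> 0 (f x)))"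

primrec iterated_group :: "('a, 'b) monoid_scheme \<Rightarrow> nat \<Rightarrow> (nat \<Rightarrow> 'a) \<Rightarrow> 'a" where
  "iterated_group G 0 x = \<one>\<^bsub>G\<^esub>"
| "iterated_group G (Suc k) x = iterated_group G k x \<otimes>\<^bsub>G\<^esub> x (Suc k)"

text \<open>The group ranges over groups whose elements have the same type as those of \<open>Q\<close>. This is
  no restriction, since its carrier must be in bijection with \<open>Q\<close>; see the lemma below.\<close>

definition isotopic_to_iterated_group :: "nat \<Rightarrow> 'a set \<Rightarrow> ((nat \<Rightarrow> 'a) \<Rightarrow> 'a) \<Rightarrow> bool" where
  "isotopic_to_iterated_group k Q f \<longleftrightarrow>
     (\<exists>G :: 'a monoid. group G \<and> isotopic k Q f (carrier G) (iterated_group G k))"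

lemma isotopic_to_iterated_group_any_type:
  fixes G :: "('b, 'c) monoid_scheme" and Q :: "'a set"
  assumes G: "group G" and iso: "isotopic k Q f (carrier G) (iterated_group G k)"
  shows "isotopic_to_iterated_group k Q f"
proof -
  interpret group G by (rule G)
  from iso obtain \<alpha> where bij: "\<And>i. i \<le> k \<Longrightarrow> bij_betw (\<alpha> i) Q (carrier G)"
    and eq: "\<And>x. x \<in> {1..k} \<rightarrow>\<^sub>E Q \<Longrightarrow>
      iterated_group G k (\<lambda>i\<in>{1..k}. \<alpha> i (x i)) = \<alpha> 0 (f x)"
    unfolding isotopic_def by (meson atLeastAtMost_iff le0)
  have bij0: "bij_betw (\<alpha> 0) Q (carrier G)" by (simp add: bij)
  define \<beta> where "\<beta> = restrict (inv_into Q (\<alpha> 0)) (carrier G)"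
  have \<beta>: "bij_betw \<beta> (carrier G) Q"
    unfolding \<beta>_def using bij_betw_inv_into[OF bij0] by simp
  have \<alpha>\<beta>: "\<alpha> 0 (\<beta> x) = x" if "x \<in> carrier G" for x
    using that bij0 by (simp add: \<beta>_def bij_betw_def f_inv_into_f)
  define H :: "'a monoid" where
    "H = \<lparr>carrier = Q, mult = \<lambda>x y. \<beta> (\<alpha> 0 x \<otimes>\<^bsub>G\<^esub> \<alpha> 0 y), one = \<beta> \<one>\<^bsub>G\<^esub>\<rparr>"
  have hom: "\<beta> \<in> hom G H"
    using \<beta> by (auto simp: hom_def H_def \<alpha>\<beta> bij_betw_def)
  have "group (H\<lparr>carrier := \<beta> ` carrier G, one := \<beta> \<one>\<^bsub>G\<^esub>\<rparr>)"
    by (rule hom_imp_img_group[OF hom])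
  moreover have "\<beta> ` carrier G = Q" using \<beta> by (simp add: bij_betw_def)
  ultimately have H: "group H" by (simp add: H_def)
  have closed: "iterated_group G m x \<in> carrier G"
    if "\<And>i. 1 \<le> i \<Longrightarrow> i \<le> m \<Longrightarrow> x i \<in> carrier G" for m x
    using that by (induction m) auto
  have iter: "iterated_group H m y = \<beta> (iterated_group G m x)"
    if "\<And>i. 1 \<le> i \<Longrightarrow> i \<le> m \<Longrightarrow> x i \<in> carrier G \<and> y i = \<beta> (x i)" for m x y
    using that
  proof (induction m)
    case 0
    then show ?case by (simp add: H_def)
  next
    case (Suc m)
    then have "iterated_group H m y = \<beta> (iterated_group G m x)" by simp
    moreover have "x (Suc m) \<in> carrier G" "y (Suc m) = \<beta> (x (Suc m))"
      using Suc.prems[of "Suc m"] by auto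
    moreover have "iterated_group G m x \<in> carrier G"
      using Suc.prems by (intro closed) auto
    ultimately show ?case by (simp add: H_def \<alpha>\<beta>)
  qed
  have "isotopic k Q f (carrier H) (iterated_group H k)"
    unfolding isotopic_def
  proof (intro exI[of _ "\<lambda>i. \<beta> \<circ> \<alpha> i"] conjI ballI)
    fix i assume "i \<in> {0..k}"
    then have "bij_betw (\<alpha> i) Q (carrier G)" by (simp add: bij)
    then show "bij_betw (\<beta> \<circ> \<alpha> i) Q (carrier H)"
      using \<beta> by (auto simp: H_def intro: bij_betw_trans)
  next
    fix x assume x: "x \<in> {1..k} \<rightarrow>\<^sub>E Q"
    have "\<alpha> i (x i) \<in> carrier G" if "1 \<le> i" "i \<le> k" for i
      using bij[of i] x that by (auto intro: bij_betwE[THEN bspec])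
    then have "iterated_group H k (\<lambda>i\<in>{1..k}. (\<beta> \<circ> \<alpha> i) (x i)) =
      \<beta> (iterated_group G k (\<lambda>i\<in>{1..k}. \<alpha> i (x i)))"
      by (intro iter) simp
    then show "iterated_group H k (\<lambda>i\<in>{1..k}. (\<beta> \<circ> \<alpha> i) (x i)) = (\<beta> \<circ> \<alpha> 0) (f x)"
      using eq[OF x] by simp
  qed
  with H show ?thesis unfolding isotopic_to_iterated_group_def by blast
qed

end

theory Submission
  imports Defs
begin

text \<open>In an iterated ternary group the equality \<open>xyz = x'y'z\<close> does not depend on \<open>z\<close>, and
  \<open>xyz = xy'z'\<close> does not depend on \<open>x\<close>. Applied to the ternary residuals of \<open>f\<close>, this shows that
  whether two pairs of values at \<^emph>\<open>adjacent\<close> places \<open>i, i + 1\<close> give the same value of \<open>f\<close> does not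
  depend on the remaining arguments. After normalizing \<open>f\<close> to a loop with unit \<open>e\<close>, the pairs
  \<open>(u, v)\<close>, \<open>(u \<cdot> v, e)\<close> and \<open>(e, u \<cdot> v)\<close> are thus interchangeable at adjacent places, where
  \<open>u \<cdot> v = f(u, v, e, \<dots>, e)\<close>. Shifting units through the argument list gives associativity
  and collapses \<open>f(x\<^sub>1, \<dots>, x\<^sub>n)\<close> to the product \<open>x\<^sub>1 \<cdots> x\<^sub>n\<close>.\<close>

section \<open>From congruence at adjacent places to a group\<close>

lemma PiE_upd:
  assumes "x \<in> I \<rightarrow>\<^sub>E Q" "i \<in> I" "u \<in> Q"
  shows "x(i := u) \<in> I \<rightarrow>\<^sub>E Q"
  using assms by (auto simp: PiE_iff extensional_def)

text \<open>The hypothesis \<open>unit\<close> makes the group appear on \<open>Q\<close> itself,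
  with identity \<open>e\<close>, and makes the equality with the iterated product exact. All
  isotopy is left to the normalization that prepares \<open>F\<close>.\<close>

lemma iterated_group_of_adjacent_congruence:
  fixes F :: "(nat \<Rightarrow> 'a) \<Rightarrow> 'a"
  assumes n: "n \<ge> 3" and e: "e \<in> Q"
    and closed: "\<And>x. x \<in> {1..n} \<rightarrow>\<^sub>E Q \<Longrightarrow> F x \<in> Q"
    and unit: "\<And>i u. \<lbrakk>i \<in> {1..n}; u \<in> Q\<rbrakk> \<Longrightarrow> F ((\<lambda>i\<in>{1..n}. e)(i := u)) = u"
    and solvable: "\<And>i x w. \<lbrakk>i \<in> {1..n}; x \<in> {1..n} \<rightarrow>\<^sub>E Q; w \<in> Q\<rbrakk> \<Longrightarrow> \<exists>y\<in>Q. F (x(i := y)) = w"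
    and adjacent: "\<And>i x y u v u' v'.
      \<lbrakk>1 \<le> i; Suc i \<le> n; x \<in> {1..n} \<rightarrow>\<^sub>E Q; y \<in> {1..n} \<rightarrow>\<^sub>E Q; u \<in> Q; v \<in> Q; u' \<in> Q; v' \<in> Q;
       F (x(i := u, Suc i := v)) = F (x(i := u', Suc i := v'))\<rbrakk>
      \<Longrightarrow> F (y(i := u, Suc i := v)) = F (y(i := u', Suc i := v'))"
  shows "\<exists>G :: 'a monoid. group G \<and> carrier G = Q \<and>
    (\<forall>x\<in>{1..n} \<rightarrow>\<^sub>E Q. F x = iterated_group G n x)"
proof -
  define E where "E = (\<lambda>i\<in>{1..n}. e)"
  have E: "E \<in> {1..n} \<rightarrow>\<^sub>E Q" using e by (simp add: E_def)
  have Ei: "E i = e" if "1 \<le> i" "i \<le> n" for i using that by (simp add: E_def)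
  have unitE: "F (E(i := u)) = u" if "1 \<le> i" "i \<le> n" "u \<in> Q" for i u
    using unit that by (simp add: E_def)
  define m where "m u v = F (E(1 := u, 2 := v))" for u v
  have m_closed: "m u v \<in> Q" if "u \<in> Q" "v \<in> Q" for u v
    unfolding m_def using that n by (intro closed PiE_upd E) auto
  \<comment> \<open>In the context \<open>E\<close> both sides are \<open>u\<close>, and
    \<open>adjacent\<close> carries this equality to any context \<open>x\<close>.\<close>
  have shift: "F (x(i := u, Suc i := e)) = F (x(i := e, Suc i := u))"
    if "1 \<le> i" "Suc i \<le> n" "x \<in> {1..n} \<rightarrow>\<^sub>E Q" "u \<in> Q" for i x u
  proof (rule adjacent[OF that(1,2) E that(3,4) e e that(4)])
    have "E(i := u, Suc i := e) = E(i := u)" "E(i := e, Suc i := u) = E(Suc i := u)"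
      using that Ei by (auto simp: fun_eq_iff)
    then show "F (E(i := u, Suc i := e)) = F (E(i := e, Suc i := u))"
      using that by (simp add: unitE)
  qed
  \<comment> \<open>The pair moves one place to the right by two shifts: the unit at place
    \<open>i + 2\<close> first trades places with \<open>v\<close>, then with
    \<open>u\<close>.\<close>
  have m_at: "F (E(i := u, Suc i := v)) = m u v"
    if "1 \<le> i" "Suc i \<le> n" "u \<in> Q" "v \<in> Q" for i u v
    using that(1,2)
  proof (induction i rule: dec_induct)
    case base
    show ?case by (simp only: m_def Suc_1)
  next
    case (step i)
    have "F (E(i := u, Suc i := v)) = F (E(i := u, Suc i := v, Suc (Suc i) := e))"
      by (rule arg_cong[of _ _ F]) (use step Ei in \<open>auto simp: fun_eq_iff\<close>)
    also have "\<dots> = F (E(i := u, Suc i := e, Suc (Suc i) := v))"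
      using step that by (intro shift PiE_upd E) auto
    also have "E(i := u, Suc i := e, Suc (Suc i) := v) =
        E(Suc (Suc i) := v, i := u, Suc i := e)"
      by (auto simp: fun_eq_iff)
    also have "F \<dots> = F (E(Suc (Suc i) := v, i := e, Suc i := u))"
      using step that by (intro shift PiE_upd E) auto
    also have "E(Suc (Suc i) := v, i := e, Suc i := u) = E(Suc i := u, Suc (Suc i) := v)"
      using step Ei by (auto simp: fun_eq_iff)
    finally show ?case by (simp only: step.IH[OF Suc_leD[OF step.prems], symmetric])
  qed
  \<comment> \<open>In the context \<open>E\<close> both sides are \<open>m u v\<close>, so
    \<open>adjacent\<close> applies again.\<close>
  have collapse: "F (x(i := u, Suc i := v)) = F (x(i := e, Suc i := m u v))"
    if "1 \<le> i" "Suc i \<le> n" "x \<in> {1..n} \<rightarrow>\<^sub>E Q" "u \<in> Q" "v \<in> Q" for i x u v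
  proof (rule adjacent[OF that(1,2) E that(3,4,5) e m_closed[OF that(4,5)]])
    have "E(i := e, Suc i := m u v) = E(Suc i := m u v)"
      using that Ei by (auto simp: fun_eq_iff)
    then show "F (E(i := u, Suc i := v)) = F (E(i := e, Suc i := m u v))"
      using that by (simp add: unitE m_at m_closed)
  qed
  have m_unit: "m e u = u" if "u \<in> Q" for u
  proof -
    have "E(1 := e, 2 := u) = E(2 := u)" using n Ei by (auto simp: fun_eq_iff)
    then show ?thesis using n that by (simp add: m_def unitE)
  qed
  \<comment> \<open>Both products equal \<open>F\<close> at \<open>u, v, w\<close> in places 1, 2,
    3. Collapsing places 1 and 2 gives the left one; collapsing places 2 and 3 leaves a unit between
    \<open>u\<close> and \<open>m v w\<close>, which a shift moves to place 1.\<close>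
  have m_assoc: "m (m u v) w = m u (m v w)" if "u \<in> Q" "v \<in> Q" "w \<in> Q" for u v w
  proof -
    have sucs: "Suc 1 = 2" "Suc 2 = 3" by simp_all
    have "m (m u v) w = F (E(2 := m u v, 3 := w))"
      using m_at[of 2 "m u v" w] that n m_closed by simp
    also have "E(2 := m u v, 3 := w) = E(3 := w, 1 := e, 2 := m u v)"
      using n Ei by (auto simp: fun_eq_iff)
    also have "F \<dots> = F (E(3 := w, 1 := u, 2 := v))"
      by (rule collapse[of 1 "E(3 := w)" u v, unfolded sucs, symmetric])
        (use that n in \<open>simp_all add: PiE_upd[OF E] m_closed del: One_nat_def\<close>)
    also have "E(3 := w, 1 := u, 2 := v) = E(1 := u, 2 := v, 3 := w)"
      by (auto simp: fun_eq_iff)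
    also have "F \<dots> = F (E(1 := u, 2 := e, 3 := m v w))"
      by (rule collapse[of 2 "E(1 := u)" v w, unfolded sucs])
        (use that n in \<open>simp_all add: PiE_upd[OF E] m_closed del: One_nat_def\<close>)
    also have "E(1 := u, 2 := e, 3 := m v w) = E(3 := m v w, 1 := u, 2 := e)"
      by (auto simp: fun_eq_iff)
    also have "F \<dots> = F (E(3 := m v w, 1 := e, 2 := u))"
      by (rule shift[of 1 "E(3 := m v w)" u, unfolded sucs])
        (use that n in \<open>simp_all add: PiE_upd[OF E] m_closed del: One_nat_def\<close>)
    also have "E(3 := m v w, 1 := e, 2 := u) = E(2 := u, 3 := m v w)"
      using n Ei by (auto simp: fun_eq_iff)
    also have "F \<dots> = m u (m v w)"
      using m_at[of 2 u "m v w"] that n m_closed by simp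
    finally show ?thesis .
  qed
  define G :: "'a monoid" where "G = \<lparr>carrier = Q, mult = m, one = e\<rparr>"
  have "group G"
  proof (rule groupI)
    \<comment> \<open>By \<open>groupI\<close> left inverses suffice; solving for the argument at
      place 1, with \<open>v\<close> at place 2, gives one.\<close>
    fix v assume "v \<in> carrier G"
    then have v: "v \<in> Q" by (simp add: G_def)
    obtain y where y: "y \<in> Q" "F (E(2 := v, 1 := y)) = e"
      using solvable[OF _ PiE_upd[OF E _ v] e, of 1 2] n by auto
    have "E(2 := v, 1 := y) = E(1 := y, 2 := v)" by (auto simp: fun_eq_iff)
    then have "m y v = e" using y by (simp only: m_def)
    with y show "\<exists>y\<in>carrier G. y \<otimes>\<^bsub>G\<^esub> v = \<one>\<^bsub>G\<^esub>" by (auto simp: G_def)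
  qed (simp_all add: G_def e m_closed m_unit m_assoc)
  moreover have "F x = iterated_group G n x" if x: "x \<in> {1..n} \<rightarrow>\<^sub>E Q" for x
  proof -
    define p where "p = (\<lambda>k. iterated_group G k x)"
    have xQ: "x i \<in> Q" if "1 \<le> i" "i \<le> n" for i using x that by auto
    have p: "p k \<in> Q" if "k \<le> n" for k
      using that by (induction k) (simp_all add: p_def G_def e m_closed xQ)
    \<comment> \<open>The first \<open>k\<close> arguments are compressed into their product at
      place \<open>k\<close>, preceded by units. One collapse at places \<open>k\<close> and
      \<open>k + 1\<close> passes from \<open>h k\<close> to \<open>h (Suc k)\<close>.\<close>
    define h where "h k = (\<lambda>i\<in>{1..n}. if i < k then e else if i = k then p k else x i)" for k
    have Fh: "F x = F (h k)" if "1 \<le> k" "k \<le> n" for k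
      using that
    proof (induction k rule: dec_induct)
      case base
      have "p 1 = x 1" using n by (simp add: p_def G_def m_unit xQ)
      then have "h 1 = x" using x by (auto simp: h_def fun_eq_iff PiE_iff extensional_def)
      then show ?case by simp
    next
      case (step k)
      have hk: "h k \<in> {1..n} \<rightarrow>\<^sub>E Q" using step by (auto simp: h_def e p xQ)
      have "F (h k) = F ((h k)(k := p k, Suc k := x (Suc k)))"
        by (rule arg_cong[of _ _ F]) (use step in \<open>auto simp: h_def fun_eq_iff\<close>)
      also have "\<dots> = F ((h k)(k := e, Suc k := m (p k) (x (Suc k))))"
        using step by (intro collapse hk p xQ) auto
      also have "(h k)(k := e, Suc k := m (p k) (x (Suc k))) = h (Suc k)"
        using step by (auto simp: h_def fun_eq_iff p_def G_def)
      finally show ?case using step by simp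
    qed
    have "h n = E(n := p n)" using n by (auto simp: h_def E_def fun_eq_iff)
    then have "F x = F (E(n := p n))" using Fh[of n] n by simp
    also have "\<dots> = p n" using n p by (intro unitE) auto
    finally show ?thesis by (simp only: p_def)
  qed
  ultimately show ?thesis by (auto simp: G_def)
qed

section \<open>Congruence at adjacent places from the ternary residuals\<close>

text \<open>The isotopy turns the values into products in a group, where an outer factor can be
  cancelled and replaced by another. A middle factor cannot be cancelled like this in a nonabelian
  group, so the two varying places must be adjacent.\<close>

lemma ternary_iterated_group_congruence:
  fixes t :: "'a \<Rightarrow> 'a \<Rightarrow> 'a \<Rightarrow> 'a"
  assumes iso: "isotopic_to_iterated_group 3 Q (\<lambda>y. t (y 1) (y 2) (y 3))"
    and t: "\<And>x y z. \<lbrakk>x \<in> Q; y \<in> Q; z \<in> Q\<rbrakk> \<Longrightarrow> t x y z \<in> Q"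
    and Q: "x \<in> Q" "y \<in> Q" "z \<in> Q" "x' \<in> Q" "y' \<in> Q" "z' \<in> Q"
  shows "t x y z = t x' y' z \<Longrightarrow> t x y z' = t x' y' z'"
    and "t x y z = t x y' z' \<Longrightarrow> t x' y z = t x' y' z'"
proof -
  from iso obtain G :: "'a monoid" and \<alpha> where "group G"
    and bij: "\<And>i. i \<le> 3 \<Longrightarrow> bij_betw (\<alpha> i) Q (carrier G)"
    and eq: "\<And>x. x \<in> {1..3} \<rightarrow>\<^sub>E Q \<Longrightarrow>
      iterated_group G 3 (\<lambda>i\<in>{1..3}. \<alpha> i (x i)) = \<alpha> 0 (t (x 1) (x 2) (x 3))"
    unfolding isotopic_to_iterated_group_def isotopic_def by (metis atLeastAtMost_iff le0)
  interpret group G by fact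
  have \<alpha>: "\<alpha> i u \<in> carrier G" if "i \<le> 3" "u \<in> Q" for i u
    using bij that by (auto dest: bij_betwE)
  have prod: "\<alpha> 0 (t u v w) = \<alpha> 1 u \<otimes>\<^bsub>G\<^esub> \<alpha> 2 v \<otimes>\<^bsub>G\<^esub> \<alpha> 3 w" if "u \<in> Q" "v \<in> Q" "w \<in> Q" for u v w
    using eq[of "\<lambda>i\<in>{1..3}. if i = 1 then u else if i = 2 then v else w"] that
    by (simp add: numeral_3_eq_3 numeral_2_eq_2 \<alpha>)
  have inj: "r = s" if "\<alpha> 0 r = \<alpha> 0 s" "r \<in> Q" "s \<in> Q" for r s
    using bij[of 0] that by (auto simp: bij_betw_def inj_on_def)
  show "t x y z' = t x' y' z'" if "t x y z = t x' y' z"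
  proof (rule inj)
    have "\<alpha> 1 x \<otimes>\<^bsub>G\<^esub> \<alpha> 2 y \<otimes>\<^bsub>G\<^esub> \<alpha> 3 z = \<alpha> 1 x' \<otimes>\<^bsub>G\<^esub> \<alpha> 2 y' \<otimes>\<^bsub>G\<^esub> \<alpha> 3 z"
      using that Q by (simp only: prod[symmetric])
    then show "\<alpha> 0 (t x y z') = \<alpha> 0 (t x' y' z')"
      using Q by (simp add: prod \<alpha>)
  qed (use t Q in auto)
  show "t x' y z = t x' y' z'" if "t x y z = t x y' z'"
  proof (rule inj)
    have "\<alpha> 1 x \<otimes>\<^bsub>G\<^esub> \<alpha> 2 y \<otimes>\<^bsub>G\<^esub> \<alpha> 3 z = \<alpha> 1 x \<otimes>\<^bsub>G\<^esub> \<alpha> 2 y' \<otimes>\<^bsub>G\<^esub> \<alpha> 3 z'"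
      using that Q by (simp only: prod[symmetric])
    then show "\<alpha> 0 (t x' y z) = \<alpha> 0 (t x' y' z')"
      using Q by (simp add: prod \<alpha> m_assoc)
  qed (use t Q in auto)
qed

text \<open>The context is changed from \<open>x\<close> to \<open>y\<close> one argument at a time.
  Changing place \<open>k\<close> involves only the residual in \<open>k\<close>, \<open>i\<close>
  and \<open>i + 1\<close>, where \<open>k\<close> is an outer place.\<close>

lemma residual_ternary_adjacent_congruence:
  assumes f: "f \<in> ({1..n} \<rightarrow>\<^sub>E Q) \<rightarrow> Q"
    and res: "\<forall>g\<in>residual_ternary_quasigroups n Q f. isotopic_to_iterated_group 3 Q g"
    and i: "1 \<le> i" "Suc i \<le> n"
    and x: "x \<in> {1..n} \<rightarrow>\<^sub>E Q" and y: "y \<in> {1..n} \<rightarrow>\<^sub>E Q"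
    and Q: "u \<in> Q" "v \<in> Q" "u' \<in> Q" "v' \<in> Q"
    and eq: "f (x(i := u, Suc i := v)) = f (x(i := u', Suc i := v'))"
  shows "f (y(i := u, Suc i := v)) = f (y(i := u', Suc i := v'))"
proof -
  have tern: "isotopic_to_iterated_group 3 Q
      (\<lambda>w. f (z(a := w 1, b := w 2, c := w 3)))"
    if "1 \<le> a" "a < b" "b < c" "c \<le> n" "z \<in> {1..n} \<rightarrow>\<^sub>E Q" for a b c z
  proof -
    \<comment> \<open>A residual is indexed by a tuple without the three free coordinates. Dropping
      them is harmless, as they are overwritten.\<close>
    define z' where "z' = restrict z ({1..n} - {a, b, c})"
    have "z(a := r, b := s, c := t) = z'(a := r, b := s, c := t)" for r s t
      using that by (auto simp: z'_def fun_eq_iff PiE_iff extensional_def)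
    then have "(\<lambda>w. f (z(a := w 1, b := w 2, c := w 3))) =
        (\<lambda>w. f (z'(a := w 1, b := w 2, c := w 3)))" by simp
    moreover have "z' \<in> {1..n} - {a, b, c} \<rightarrow>\<^sub>E Q" using that by (auto simp: z'_def)
    ultimately have "(\<lambda>w. f (z(a := w 1, b := w 2, c := w 3))) \<in> residual_ternary_quasigroups n Q f"
      unfolding residual_ternary_quasigroups_def using that(1-4) by blast
    with res show ?thesis by (rule bspec)
  qed
  have step: "f (z(k := w, i := u, Suc i := v)) = f (z(k := w, i := u', Suc i := v'))"
    if z: "z \<in> {1..n} \<rightarrow>\<^sub>E Q" and k: "1 \<le> k" "k \<le> n" and w: "w \<in> Q"
      and eq: "f (z(i := u, Suc i := v)) = f (z(i := u', Suc i := v'))" for z k w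
  proof -
    have zk: "z k \<in> Q" using z k by auto
    have fQ: "f (z(a := r, b := s, c := t)) \<in> Q"
      if "1 \<le> a" "a < b" "b < c" "c \<le> n" "r \<in> Q" "s \<in> Q" "t \<in> Q" for a b c r s t
      using that by (intro funcset_mem[OF f] PiE_upd z) auto
    consider "k < i" | "k = i \<or> k = Suc i" | "Suc i < k" by linarith
    then show ?thesis
    proof cases
      case 1
      note iso = tern[OF k(1) 1 lessI i(2) z]
      show ?thesis
      proof (rule ternary_iterated_group_congruence(2)[OF iso _ zk Q(1,2) w Q(3,4)])
        show "f (z(k := p, i := q, Suc i := r)) \<in> Q" if "p \<in> Q" "q \<in> Q" "r \<in> Q" for p q r
          using 1 k i that by (intro fQ) auto
      qed (simp only: fun_upd_triv eq)
    next
      case 2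
      then have "z(k := w, i := r, Suc i := s) = z(i := r, Suc i := s)" for r s
        by (auto simp: fun_eq_iff)
      then show ?thesis using eq by simp
    next
      case 3
      note iso = tern[OF i(1) lessI 3 k(2) z]
      \<comment> \<open>The updates are reordered to match the residual, whose free variables are in
        increasing order.\<close>
      have twist: "z(k := t, i := r, Suc i := s) = z(i := r, Suc i := s, k := t)" for r s t
        using 3 by (auto simp: fun_eq_iff)
      have triv: "z(i := r, Suc i := s, k := z k) = z(i := r, Suc i := s)" for r s
        using 3 by (auto simp: fun_eq_iff)
      show ?thesis
        unfolding twist
      proof (rule ternary_iterated_group_congruence(1)[OF iso _ Q(1,2) zk Q(3,4) w])
        show "f (z(i := p, Suc i := q, k := r)) \<in> Q" if "p \<in> Q" "q \<in> Q" "r \<in> Q" for p q r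
          using 3 k i that by (intro fQ) auto
      qed (simp only: triv eq)
    qed
  qed
  \<comment> \<open>Hybrid contexts, running from \<open>x\<close> at \<open>m = 0\<close> to
    \<open>y\<close> at \<open>m = n\<close>.\<close>
  define h where "h m = (\<lambda>j. if j \<le> m then y j else x j)" for m
  have h: "h m \<in> {1..n} \<rightarrow>\<^sub>E Q" for m
    using x y by (auto simp: h_def PiE_iff extensional_def)
  have "f ((h m)(i := u, Suc i := v)) = f ((h m)(i := u', Suc i := v'))" if "m \<le> n" for m
    using that
  proof (induction m)
    case 0
    have "h 0 = x" using x y by (auto simp: h_def fun_eq_iff PiE_iff extensional_def)
    then show ?case by (simp only: eq)
  next
    case (Suc m)
    have hSuc: "h (Suc m) = (h m)(Suc m := y (Suc m))"
      by (auto simp: h_def fun_eq_iff le_Suc_eq)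
    have ySuc: "y (Suc m) \<in> Q" using y Suc.prems by auto
    show ?case
      unfolding hSuc by (rule step[OF h _ Suc.prems ySuc Suc.IH[OF Suc_leD[OF Suc.prems]]]) simp
  qed
  moreover have "h n = y" using x y by (auto simp: h_def fun_eq_iff PiE_iff extensional_def)
  ultimately show ?thesis by (metis order_refl)
qed

section \<open>Normalization to a loop and conclusion\<close>

theorem theorem8p10:
  fixes Q :: "'a set" and f :: "(nat \<Rightarrow> 'a) \<Rightarrow> 'a" and n :: nat
  assumes "n \<ge> 3"
    and "nary_quasigroup n Q f"
    and "\<forall>g\<in>residual_ternary_quasigroups n Q f. isotopic_to_iterated_group 3 Q g"
  shows "isotopic_to_iterated_group n Q f"
proof -
  have f: "f \<in> ({1..n} \<rightarrow>\<^sub>E Q) \<rightarrow> Q" using assms(2) by (simp add: nary_quasigroup_def)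
  obtain b where b: "b \<in> Q" using assms(2) by (auto simp: nary_quasigroup_def)
  have ex1: "\<exists>!y. y \<in> Q \<and> f (x(i := y)) = w"
    if "i \<in> {1..n}" "x \<in> {1..n} \<rightarrow>\<^sub>E Q" "w \<in> Q" for i x w
  proof -
    have "x(i := undefined) \<in> {1..n} - {i} \<rightarrow>\<^sub>E Q"
      using that by (auto simp: PiE_iff extensional_def)
    then have "\<exists>!y. y \<in> Q \<and> f (x(i := undefined, i := y)) = w"
      using assms(2) that unfolding nary_quasigroup_def by blast
    then show ?thesis by simp
  qed
  \<comment> \<open>The base point \<open>B\<close> gives the translations \<open>\<alpha> i\<close>
    of \<open>f\<close> through it. Undoing them coordinatewise by \<open>R\<close> makes
    \<open>f (R x)\<close> a loop operation: its unit is \<open>e = f B\<close>, because every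
    \<open>\<alpha> i\<close> sends \<open>b\<close> to \<open>e\<close>.\<close>
  define B where "B = (\<lambda>i\<in>{1..n}. b)"
  have B: "B \<in> {1..n} \<rightarrow>\<^sub>E Q" using b by (simp add: B_def)
  define \<alpha> where "\<alpha> i u = f (B(i := u))" for i u
  have bij: "bij_betw (\<alpha> i) Q Q" if "i \<in> {1..n}" for i
  proof (rule bij_betwI')
    show "\<alpha> i u = \<alpha> i v \<longleftrightarrow> u = v" if "u \<in> Q" "v \<in> Q" for u v
      using ex1[OF \<open>i \<in> {1..n}\<close> B, of "\<alpha> i u"] that \<open>i \<in> {1..n}\<close> f B
      unfolding \<alpha>_def by (metis PiE_upd funcset_mem)
    show "\<alpha> i u \<in> Q" if "u \<in> Q" for u
      unfolding \<alpha>_def using that \<open>i \<in> {1..n}\<close> by (intro funcset_mem[OF f] PiE_upd B)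
    show "\<exists>u\<in>Q. w = \<alpha> i u" if "w \<in> Q" for w
      using ex1[OF \<open>i \<in> {1..n}\<close> B that] unfolding \<alpha>_def by blast
  qed
  define \<beta> where "\<beta> i = inv_into Q (\<alpha> i)" for i
  have \<beta>: "\<beta> i u \<in> Q" "\<alpha> i (\<beta> i u) = u" if "i \<in> {1..n}" "u \<in> Q" for i u
    using bij[OF that(1)] that(2) unfolding \<beta>_def bij_betw_def
    by (auto intro: inv_into_into f_inv_into_f)
  have \<beta>\<alpha>: "\<beta> i (\<alpha> i u) = u" "\<alpha> i u \<in> Q" if "i \<in> {1..n}" "u \<in> Q" for i u
    using bij[OF that(1)] that(2) unfolding \<beta>_def bij_betw_def by auto
  define R where "R x = (\<lambda>i\<in>{1..n}. \<beta> i (x i))" for x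
  have R: "R x \<in> {1..n} \<rightarrow>\<^sub>E Q" if "x \<in> {1..n} \<rightarrow>\<^sub>E Q" for x
    using that by (auto simp: R_def intro!: \<beta>(1) dest: PiE_mem)
  have R_upd: "R (x(i := u)) = (R x)(i := \<beta> i u)" if "i \<in> {1..n}" for x i u
    using that by (auto simp: R_def fun_eq_iff)
  define e where "e = f B"
  have e: "e \<in> Q" unfolding e_def by (rule funcset_mem[OF f B])
  have "\<beta> i e = b" if "i \<in> {1..n}" for i
  proof -
    have "B(i := b) = B" using that by (auto simp: B_def fun_eq_iff)
    then have "e = \<alpha> i b" by (simp add: \<alpha>_def e_def)
    then show ?thesis using \<beta>\<alpha> b that by simp
  qed
  then have RE: "R (\<lambda>i\<in>{1..n}. e) = B" by (auto simp: R_def B_def fun_eq_iff)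
  have "\<exists>G :: 'a monoid. group G \<and> carrier G = Q \<and>
    (\<forall>x\<in>{1..n} \<rightarrow>\<^sub>E Q. f (R x) = iterated_group G n x)"
  proof (rule iterated_group_of_adjacent_congruence[OF assms(1) e])
    show "f (R x) \<in> Q" if "x \<in> {1..n} \<rightarrow>\<^sub>E Q" for x
      by (rule funcset_mem[OF f R[OF that]])
    show "f (R ((\<lambda>i\<in>{1..n}. e)(i := u))) = u" if "i \<in> {1..n}" "u \<in> Q" for i u
      using \<beta>(2)[OF that] unfolding R_upd[OF that(1)] RE \<alpha>_def .
    show "\<exists>y\<in>Q. f (R (x(i := y))) = w"
      if i: "i \<in> {1..n}" and xw: "x \<in> {1..n} \<rightarrow>\<^sub>E Q" "w \<in> Q" for i x w
    proof -
      obtain y where y: "y \<in> Q" "f ((R x)(i := y)) = w"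
        using ex1[OF i R[OF xw(1)] xw(2)] by blast
      then have "f (R (x(i := \<alpha> i y))) = w" using i by (simp add: R_upd \<beta>\<alpha>)
      then show ?thesis using \<beta>\<alpha>(2) y i by blast
    qed
    \<comment> \<open>Since \<open>R\<close> acts coordinatewise, this is the congruence for
      \<open>f\<close> at the pairs transformed by \<open>\<beta> i\<close> and
      \<open>\<beta> (Suc i)\<close>.\<close>
    show "f (R (y(i := u, Suc i := v))) = f (R (y(i := u', Suc i := v')))"
      if i: "1 \<le> i" "Suc i \<le> n" and xy: "x \<in> {1..n} \<rightarrow>\<^sub>E Q" "y \<in> {1..n} \<rightarrow>\<^sub>E Q"
        and Q: "u \<in> Q" "v \<in> Q" "u' \<in> Q" "v' \<in> Q"
        and eq: "f (R (x(i := u, Suc i := v))) = f (R (x(i := u', Suc i := v')))"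
      for i x y u v u' v'
    proof -
      have ii: "i \<in> {1..n}" "Suc i \<in> {1..n}" using i by auto
      show ?thesis
        unfolding R_upd[OF ii(1)] R_upd[OF ii(2)]
        by (rule residual_ternary_adjacent_congruence[OF f assms(3) i R[OF xy(1)] R[OF xy(2)]])
          (use ii Q \<beta> eq in \<open>simp_all only: R_upd\<close>)
    qed
  qed
  then obtain G :: "'a monoid" where G: "group G" "carrier G = Q"
    and iter: "\<And>x. x \<in> {1..n} \<rightarrow>\<^sub>E Q \<Longrightarrow> f (R x) = iterated_group G n x" by blast
  have "isotopic n Q f (carrier G) (iterated_group G n)"
    unfolding isotopic_def G(2)
  \<comment> \<open>Applying \<open>\<alpha> i\<close> to the arguments is inverse to
    \<open>R\<close>, so the values of \<open>f\<close> need no change and the bijection at index 0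
    is the identity.\<close>
  proof (intro exI[of _ "\<lambda>i. if i = 0 then id else \<alpha> i"] conjI ballI)
    show "bij_betw (if i = 0 then id else \<alpha> i) Q Q" if "i \<in> {0..n}" for i
      using bij that by auto
  next
    fix x assume x: "x \<in> {1..n} \<rightarrow>\<^sub>E Q"
    let ?y = "\<lambda>i\<in>{1..n}. \<alpha> i (x i)"
    have y: "?y \<in> {1..n} \<rightarrow>\<^sub>E Q" using x by (auto intro!: \<beta>\<alpha>(2) dest: PiE_mem)
    have "R ?y = x" using x \<beta>\<alpha> by (auto simp: R_def fun_eq_iff PiE_iff extensional_def)
    moreover have "(\<lambda>i\<in>{1..n}. (if i = 0 then id else \<alpha> i) (x i)) = ?y"
      by (auto simp: fun_eq_iff)
    ultimately show "iterated_group G n (\<lambda>i\<in>{1..n}. (if i = 0 then id else \<alpha> i) (x i)) =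
        (if 0 = (0::nat) then id else \<alpha> 0) (f x)"
      using iter[OF y] by simp
  qed
  with G(1) show ?thesis unfolding isotopic_to_iterated_group_def by blast
qed

end
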